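(* Let $(M,\mathcal{C},\mathcal{C}^* )$ be an orthogonally oriented matroid on $E = X \,\dot\cup\, F \,\dot\cup\, G$ and let $N = M/F\setminus G$, a matroid on $X$. Let $\mathcal{C}_N$ be the set of signed subsets $C|_{\underline{C'}}$, where $\underline{C'}$ ranges over the circuits of $N$ and $C$ ranges over the elements of $\mathcal{C}$ with $\underline{C'} \subseteq \underline{C} \subseteq \underline{C'} \cup F$. Let $\mathcal{C}^*_N$ be the set of signed subsets $U|_{\underline{U'}}$, where $\underline{U'}$ ranges over the cocircuits of $N$ and $U$ ranges over the elements of $\mathcal{C}^*$ with $\underline{U'} \subseteq \underline{U} \subseteq \underline{U'} \cup G$. Then $(N,\mathcal{C}_N,\mathcal{C}^*_N)$ is an orthogonally oriented matroid on $X$; in particular $N$ is orthogonally orientable.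
   Context: Matroids are matroids in the sense of Bruhn, Diestel, Kriesell, Pendavingh and Wollan, on a possibly infinite ground set; cocircuits of $M$ are the circuits of the dual $M^*$, and minors $M/F\setminus G$ are defined as usual. A signed subset $X$ of $E$ is a subset $\underline{X}\subseteq E$ (its support) together with a partition $(X^+,X^-)$ of $\underline{X}$; write $X(e)=1$ if $e\in X^+$ and $X(e)=-1$ if $e\in X^-$. The opposite $-X$ has $(-X)^+=X^-$, $(-X)^-=X^+$. For $A\subseteq E$, the restriction $X|_A$ has $(X|_A)^+=X^+\cap A$, $(X|_A)^-=X^-\cap A$. Two signed subsets $X,Y$ are orthogonal if either $\underline{X}\cap\underline{Y}=\emptyset$ or there are $e,f\in\underline{X}\cap\underline{Y}$ with $X(e)Y(e)=-X(f)Y(f)$. A circuit signature of a matroid $M$ is a set $\mathcal{C}$ of signed subsets consisting of exactly two opposite signed subsets $C,-C$ with support $\underline{C}$ for each circuit $\underline{C}$ of $M$ (and nothing else); a cocircuit signature of $M$ is a circuit signature of $M^*$. A triple $(M,\mathcal{C},\mathcal{C}^* )$, with $\mathcal{C}$ a circuit signature and $\mathcal{C}^*$ a cocircuit signature of $M$, is an orthogonally oriented matroid if every element of $\mathcal{C}$ is orthogonal to every element of $\mathcal{C}^*$; $M$ is then called orthogonally orientable. (In the situation of the claim, $\mathcal{C}_N$ and $\mathcal{C}^*_N$ are known to be a circuit signature and a cocircuit signature of $N$, the induced signatures.) *)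

theory Defs
  imports Main
begin

section \<open>Matroids on possibly infinite ground sets\<close>

datatype 'a indep_system =
  Indep_System (ground: "'a set") (indep_sets: "'a set set")

definition bases :: "'a indep_system \<Rightarrow> 'a set set" where
  "bases M = {B \<in> indep_sets M. \<forall>I \<in> indep_sets M. B \<subseteq> I \<longrightarrow> I = B}"

text \<open>The independence axioms (I1), (I2), (I3), (IM) of Bruhn, Diestel, Kriesell,
  Pendavingh and Wollan, in this order after the condition on the ground set.\<close>

definition matroid :: "'a indep_system \<Rightarrow> bool" where
  "matroid M \<longleftrightarrow>
     indep_sets M \<subseteq> Pow (ground M) \<and>
     {} \<in> indep_sets M \<and>
     (\<forall>I \<in> indep_sets M. \<forall>J. J \<subseteq> I \<longrightarrow> J \<in> indep_sets M) \<and>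
     (\<forall>I \<in> indep_sets M - bases M. \<forall>B \<in> bases M.
        \<exists>x \<in> B - I. insert x I \<in> indep_sets M) \<and>
     (\<forall>I \<in> indep_sets M. \<forall>X. I \<subseteq> X \<and> X \<subseteq> ground M \<longrightarrow>
        (\<exists>J \<in> indep_sets M. I \<subseteq> J \<and> J \<subseteq> X \<and>
           (\<forall>K \<in> indep_sets M. J \<subseteq> K \<and> K \<subseteq> X \<longrightarrow> K = J)))"

definition circuits :: "'a indep_system \<Rightarrow> 'a set set" where
  "circuits M = {C. C \<subseteq> ground M \<and> C \<notin> indep_sets M \<and> (\<forall>D. D \<subset> C \<longrightarrow> D \<in> indep_sets M)}"

text \<open>The bases of the dual are the complements of the bases.\<close>

definition dual :: "'a indep_system \<Rightarrow> 'a indep_system" where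
  "dual M = Indep_System (ground M) {I. \<exists>B \<in> bases M. I \<subseteq> ground M - B}"

definition cocircuits :: "'a indep_system \<Rightarrow> 'a set set" where
  "cocircuits M = circuits (dual M)"

definition deletion :: "'a indep_system \<Rightarrow> 'a set \<Rightarrow> 'a indep_system" where
  "deletion M G = Indep_System (ground M - G) {I \<in> indep_sets M. I \<subseteq> ground M - G}"

definition contraction :: "'a indep_system \<Rightarrow> 'a set \<Rightarrow> 'a indep_system" where
  "contraction M F = dual (deletion (dual M) F)"

section \<open>Signed sets\<close>

typedef 'a signed_set = "{(P :: 'a set, N :: 'a set). P \<inter> N = {}}"
  by auto

setup_lifting type_definition_signed_set

lift_definition pos :: "'a signed_set \<Rightarrow> 'a set" is fst .

lift_definition neg :: "'a signed_set \<Rightarrow> 'a set" is snd .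

definition support :: "'a signed_set \<Rightarrow> 'a set" where
  "support X = pos X \<union> neg X"

text \<open>The value is only meaningful on the support; it is 0 elsewhere.\<close>

definition sign :: "'a signed_set \<Rightarrow> 'a \<Rightarrow> int" where
  "sign X e = (if e \<in> pos X then 1 else if e \<in> neg X then -1 else 0)"

lift_definition opposite :: "'a signed_set \<Rightarrow> 'a signed_set" is
  "\<lambda>(P, N). (N, P)" by auto

lift_definition restriction :: "'a signed_set \<Rightarrow> 'a set \<Rightarrow> 'a signed_set" is
  "\<lambda>(P, N) A. (P \<inter> A, N \<inter> A)" by auto

definition orthogonal :: "'a signed_set \<Rightarrow> 'a signed_set \<Rightarrow> bool" where
  "orthogonal X Y \<longleftrightarrow>
     support X \<inter> support Y = {} \<or>
     (\<exists>e \<in> support X \<inter> support Y. \<exists>f \<in> support X \<inter> support Y.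
        sign X e * sign Y e = - (sign X f * sign Y f))"

section \<open>Orthogonally oriented matroids\<close>

text \<open>Circuits of a matroid are nonempty, so the two opposite signed sets with the same
  circuit as support are distinct.\<close>

definition circuit_signature :: "'a indep_system \<Rightarrow> 'a signed_set set \<Rightarrow> bool" where
  "circuit_signature M \<C> \<longleftrightarrow>
     (\<forall>X \<in> \<C>. support X \<in> circuits M) \<and>
     (\<forall>D \<in> circuits M. \<exists>X. {Y \<in> \<C>. support Y = D} = {X, opposite X})"

definition cocircuit_signature :: "'a indep_system \<Rightarrow> 'a signed_set set \<Rightarrow> bool" where
  "cocircuit_signature M \<D> \<longleftrightarrow> circuit_signature (dual M) \<D>"

definition orthogonally_oriented_matroid ::
    "'a indep_system \<Rightarrow> 'a signed_set set \<Rightarrow> 'a signed_set set \<Rightarrow> bool" where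
  "orthogonally_oriented_matroid M \<C> \<D> \<longleftrightarrow>
     matroid M \<and> circuit_signature M \<C> \<and> cocircuit_signature M \<D> \<and>
     (\<forall>X \<in> \<C>. \<forall>Y \<in> \<D>. orthogonal X Y)"

definition orthogonally_orientable :: "'a indep_system \<Rightarrow> bool" where
  "orthogonally_orientable M \<longleftrightarrow> (\<exists>\<C> \<D>. orthogonally_oriented_matroid M \<C> \<D>)"

lemma pos_neg_disjoint: "pos X \<inter> neg X = {}"
  by transfer auto

lemma signed_set_eqI: "pos X = pos Y \<Longrightarrow> neg X = neg Y \<Longrightarrow> X = Y"
  by transfer auto

lemma opposite_simps [simp]: "pos (opposite X) = neg X" "neg (opposite X) = pos X"
  by (transfer; auto)+

lemma restriction_simps [simp]:
  "pos (restriction X A) = pos X \<inter> A" "neg (restriction X A) = neg X \<inter> A"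
  by (transfer; auto)+

end

theory Submission
  imports Defs
begin

text \<open>A circuit of \<open>N = M/F\G\<close> lifts to a circuit of \<open>M\<close> that only gains elements of \<open>F\<close>, a
  cocircuit of \<open>N\<close> lifts to a cocircuit of \<open>M\<close> that only gains elements of \<open>G\<close>, and since \<open>F\<close> and
  \<open>G\<close> are disjoint, lifting does not change the intersection of a circuit with a cocircuit. This
  gives orthogonality. Any two elements \<open>e, f\<close> of a circuit \<open>D\<close> of \<open>N\<close> are cut out of \<open>D\<close> by some
  cocircuit of \<open>N\<close>, and orthogonality to a lift of that cocircuit determines the relative sign of
  \<open>e\<close> and \<open>f\<close> in every lift of \<open>D\<close>, so that \<open>D\<close> inherits exactly two opposite signings. As
  \<open>N\<^sup>* = M\<^sup>*/G\F\<close>, the cocircuits are covered by the same argument in the dual.\<close>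

section \<open>Independent sets and bases\<close>

definition bases_in :: "'a indep_system \<Rightarrow> 'a set \<Rightarrow> 'a set set" where
  "bases_in M X =
     {B \<in> indep_sets M. B \<subseteq> X \<and> (\<forall>K \<in> indep_sets M. B \<subseteq> K \<and> K \<subseteq> X \<longrightarrow> K = B)}"

lemma bases_inI:
  assumes "B \<in> indep_sets M" "B \<subseteq> X"
    and "\<And>K. K \<in> indep_sets M \<Longrightarrow> B \<subseteq> K \<Longrightarrow> K \<subseteq> X \<Longrightarrow> K = B"
  shows "B \<in> bases_in M X"
  using assms by (simp add: bases_in_def)

lemma bases_in_indep: "B \<in> bases_in M X \<Longrightarrow> B \<in> indep_sets M"
  by (simp add: bases_in_def)

lemma bases_in_subset: "B \<in> bases_in M X \<Longrightarrow> B \<subseteq> X"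
  by (simp add: bases_in_def)

lemma bases_in_maximal:
  "B \<in> bases_in M X \<Longrightarrow> K \<in> indep_sets M \<Longrightarrow> B \<subseteq> K \<Longrightarrow> K \<subseteq> X \<Longrightarrow> K = B"
  by (simp add: bases_in_def)

lemma bases_in_antimono: "B \<in> bases_in M X \<Longrightarrow> B \<subseteq> Y \<Longrightarrow> Y \<subseteq> X \<Longrightarrow> B \<in> bases_in M Y"
  unfolding bases_in_def by blast

lemma bases_indep: "B \<in> bases M \<Longrightarrow> B \<in> indep_sets M"
  by (simp add: bases_def)

lemma bases_maximal: "B \<in> bases M \<Longrightarrow> I \<in> indep_sets M \<Longrightarrow> B \<subseteq> I \<Longrightarrow> I = B"
  by (simp add: bases_def)

lemma psubset_not_base: "B \<in> bases M \<Longrightarrow> I \<subset> B \<Longrightarrow> I \<notin> bases M"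
  using bases_indep bases_maximal by blast

lemma matroid_indep_subset_ground: "matroid M \<Longrightarrow> I \<in> indep_sets M \<Longrightarrow> I \<subseteq> ground M"
  by (auto simp: matroid_def)

lemma matroid_empty_indep: "matroid M \<Longrightarrow> {} \<in> indep_sets M"
  by (simp add: matroid_def)

lemma matroid_indep_subset: "matroid M \<Longrightarrow> I \<in> indep_sets M \<Longrightarrow> J \<subseteq> I \<Longrightarrow> J \<in> indep_sets M"
  by (simp add: matroid_def)

lemma matroid_augment:
  assumes "matroid M" "I \<in> indep_sets M" "I \<notin> bases M" "B \<in> bases M"
  obtains x where "x \<in> B - I" "insert x I \<in> indep_sets M"
  using assms unfolding matroid_def by (meson DiffI)

lemma matroidI:
  assumes "\<And>I. I \<in> indep_sets M \<Longrightarrow> I \<subseteq> ground M"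
    and "{} \<in> indep_sets M"
    and "\<And>I J. I \<in> indep_sets M \<Longrightarrow> J \<subseteq> I \<Longrightarrow> J \<in> indep_sets M"
    and "\<And>I B. I \<in> indep_sets M \<Longrightarrow> I \<notin> bases M \<Longrightarrow> B \<in> bases M \<Longrightarrow>
      \<exists>x \<in> B - I. insert x I \<in> indep_sets M"
    and "\<And>I X. I \<in> indep_sets M \<Longrightarrow> I \<subseteq> X \<Longrightarrow> X \<subseteq> ground M \<Longrightarrow> \<exists>J \<in> bases_in M X. I \<subseteq> J"
  shows "matroid M"
  unfolding matroid_def
proof (intro conjI ballI allI impI)
  fix I X assume "I \<in> indep_sets M" "I \<subseteq> X \<and> X \<subseteq> ground M"
  then obtain J where "J \<in> bases_in M X" "I \<subseteq> J" using assms(5) by blast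
  then show "\<exists>J \<in> indep_sets M. I \<subseteq> J \<and> J \<subseteq> X \<and>
      (\<forall>K \<in> indep_sets M. J \<subseteq> K \<and> K \<subseteq> X \<longrightarrow> K = J)"
    unfolding bases_in_def by blast
qed (use assms(1-4) in auto)

lemma indep_extends_to_bases_in:
  assumes M: "matroid M" and I: "I \<in> indep_sets M" "I \<subseteq> X"
  obtains J where "J \<in> bases_in M X" "I \<subseteq> J"
proof -
  have "I \<subseteq> X \<inter> ground M"
    using I matroid_indep_subset_ground[OF M] by simp
  then obtain J where J: "J \<in> indep_sets M" "I \<subseteq> J" "J \<subseteq> X \<inter> ground M"
    and maximal: "\<forall>K \<in> indep_sets M. J \<subseteq> K \<and> K \<subseteq> X \<inter> ground M \<longrightarrow> K = J"
    using M I(1) unfolding matroid_def by (meson inf_le2)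
  have "J \<in> bases_in M X"
    using J maximal matroid_indep_subset_ground[OF M] by (intro bases_inI) auto
  then show thesis using J(2) by (rule that)
qed

lemma bases_in_exists:
  assumes "matroid M"
  obtains B where "B \<in> bases_in M X"
  using indep_extends_to_bases_in[OF assms matroid_empty_indep[OF assms] empty_subsetI] .

lemma bases_in_ground: "matroid M \<Longrightarrow> bases_in M (ground M) = bases M"
  using matroid_indep_subset_ground unfolding bases_in_def bases_def by blast

lemma bases_subset_ground: "matroid M \<Longrightarrow> B \<in> bases M \<Longrightarrow> B \<subseteq> ground M"
  by (simp add: bases_indep matroid_indep_subset_ground)

lemma indep_extends_to_base:
  assumes "matroid M" "I \<in> indep_sets M"
  obtains B where "B \<in> bases M" "I \<subseteq> B"
  using indep_extends_to_bases_in[OF assms matroid_indep_subset_ground[OF assms]]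
  unfolding bases_in_ground[OF assms(1)] .

lemma base_between:
  assumes M: "matroid M" and I: "I \<in> indep_sets M" and B: "B \<in> bases M"
  obtains B' where "B' \<in> bases M" "I \<subseteq> B'" "B' \<subseteq> I \<union> B"
proof -
  obtain J where J: "J \<in> bases_in M (I \<union> B)" "I \<subseteq> J"
    by (rule indep_extends_to_bases_in[OF M I Un_upper1])
  have "J \<in> bases M"
  proof (rule ccontr)
    assume "J \<notin> bases M"
    then obtain x where x: "x \<in> B - J" "insert x J \<in> indep_sets M"
      using matroid_augment[OF M bases_in_indep[OF J(1)] _ B] by blast
    then have "insert x J = J"
      using bases_in_maximal[OF J(1)] bases_in_subset[OF J(1)] by blast
    then show False using x by blast
  qed
  then show thesis using J bases_in_subset[OF J(1)] by (intro that)
qed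

lemma bases_in_Int_indep:
  assumes M: "matroid M" and J: "J \<in> bases_in M X" and I: "I \<in> indep_sets M" "J \<subseteq> I"
  shows "I \<inter> X = J"
  using bases_in_maximal[OF J matroid_indep_subset[OF M I(1)]] bases_in_subset[OF J] I(2) by blast

lemma bases_diff_subset_eq:
  assumes M: "matroid M" and B: "B \<in> bases M" "B \<inter> X \<in> bases_in M X"
    and B': "B' \<in> bases M" "B' - X \<subseteq> B"
  shows "B' - X = B - X"
proof (rule ccontr)
  let ?I = "B \<inter> X \<union> (B' - X)"
  assume "B' - X \<noteq> B - X"
  then have "?I \<subset> B" using B'(2) by blast
  then have "?I \<in> indep_sets M" "?I \<notin> bases M"
    using matroid_indep_subset[OF M bases_indep[OF B(1)]] psubset_not_base[OF B(1)] by blast+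
  then obtain x where x: "x \<in> B' - ?I" "insert x ?I \<in> indep_sets M"
    by (rule matroid_augment[OF M _ _ B'(1)])
  have "insert x (B \<inter> X) \<in> indep_sets M"
    by (rule matroid_indep_subset[OF M x(2)]) blast
  then have "insert x (B \<inter> X) = B \<inter> X"
    using bases_in_maximal[OF B(2)] x(1) by blast
  then show False using x(1) by blast
qed

lemma base_replace_bases_in:
  assumes M: "matroid M" and B: "B \<in> bases M" "B \<inter> X \<in> bases_in M X" and J: "J \<in> bases_in M X"
  shows "J \<union> (B - X) \<in> bases M"
proof -
  obtain B' where B': "B' \<in> bases M" "J \<subseteq> B'" "B' \<subseteq> J \<union> B"
    by (rule base_between[OF M bases_in_indep[OF J] B(1)])
  have "B' - X \<subseteq> B" using B'(3) bases_in_subset[OF J] by blast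
  then have "B' - X = B - X" by (rule bases_diff_subset_eq[OF M B B'(1)])
  moreover have "B' \<inter> X = J" by (rule bases_in_Int_indep[OF M J bases_indep[OF B'(1)] B'(2)])
  ultimately have "B' = J \<union> (B - X)" by blast
  then show ?thesis using B'(1) by simp
qed

text \<open>Maximal independent subsets of a set are completed to bases by the same elements outside
  it. If no element of \<open>J\<close> augmented \<open>I\<close>, this would apply to \<open>I\<close> and \<open>J\<close> in \<open>I \<union> J\<close> and to \<open>J\<close>
  and some \<open>K \<supset> I\<close> in \<open>X\<close>, giving two nested bases.\<close>

lemma bases_in_augment:
  assumes M: "matroid M" and I: "I \<in> indep_sets M" "I \<subseteq> X" "I \<notin> bases_in M X"
    and J: "J \<in> bases_in M X"
  shows "\<exists>x \<in> J - I. insert x I \<in> indep_sets M"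
proof (rule ccontr)
  let ?Y = "I \<union> J"
  assume no_augment: "\<not> ?thesis"
  have maximal: "I \<in> bases_in M ?Y"
  proof (rule bases_inI)
    fix K assume K: "K \<in> indep_sets M" "I \<subseteq> K" "K \<subseteq> ?Y"
    have "x \<in> I" if "x \<in> K" for x
      using no_augment K that matroid_indep_subset[OF M K(1), of "insert x I"] by blast
    then show "K = I" using K(2) by blast
  qed (use I in auto)
  obtain B where B: "B \<in> bases M" "J \<subseteq> B"
    by (rule indep_extends_to_base[OF M bases_in_indep[OF J]])
  have B_Int_X: "B \<inter> X = J" by (rule bases_in_Int_indep[OF M J bases_indep[OF B(1)] B(2)])
  have Y_subset: "?Y \<subseteq> X" using I(2) bases_in_subset[OF J] by blast
  then have "B \<inter> ?Y = J" using B_Int_X B(2) by blast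
  then have base_I: "I \<union> (B - ?Y) \<in> bases M"
    using base_replace_bases_in[OF M B(1) _ maximal] bases_in_antimono[OF J _ Y_subset] by simp
  obtain K where K: "K \<in> bases_in M X" "I \<subseteq> K"
    by (rule indep_extends_to_bases_in[OF M I(1,2)])
  have base_K: "K \<union> (B - X) \<in> bases M"
    using base_replace_bases_in[OF M B(1) _ K(1)] B_Int_X J by simp
  have "K \<noteq> I" using K(1) I(3) by blast
  then have "I \<union> (B - ?Y) \<subset> K \<union> (B - X)"
    using K(2) bases_in_subset[OF K(1)] B_Int_X Y_subset by blast
  then show False using psubset_not_base[OF base_K] base_I by blast
qed

section \<open>Duality\<close>

lemma ground_dual [simp]: "ground (dual M) = ground M"
  by (simp add: dual_def)

lemma indep_dual_iff: "I \<in> indep_sets (dual M) \<longleftrightarrow> (\<exists>B \<in> bases M. I \<subseteq> ground M - B)"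
  by (simp add: dual_def)

lemma indep_dualI: "B \<in> bases M \<Longrightarrow> I \<subseteq> ground M - B \<Longrightarrow> I \<in> indep_sets (dual M)"
  unfolding indep_dual_iff by (rule bexI)

lemma indep_dualE:
  assumes "I \<in> indep_sets (dual M)"
  obtains B where "B \<in> bases M" "I \<subseteq> ground M - B"
  using assms unfolding indep_dual_iff by (rule bexE)

lemma bases_dual:
  assumes M: "matroid M"
  shows "bases (dual M) = (\<lambda>B. ground M - B) ` bases M"
proof (intro equalityI subsetI)
  fix A assume A: "A \<in> bases (dual M)"
  then obtain B where B: "B \<in> bases M" "A \<subseteq> ground M - B"
    by (rule indep_dualE[OF bases_indep])
  have "ground M - B \<in> indep_sets (dual M)" by (rule indep_dualI[OF B(1) order_refl])
  then have "ground M - B = A" using B(2) by (rule bases_maximal[OF A])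
  then show "A \<in> (\<lambda>B. ground M - B) ` bases M" using B(1) by blast
next
  fix A assume "A \<in> (\<lambda>B. ground M - B) ` bases M"
  then obtain B where B: "B \<in> bases M" "A = ground M - B" by blast
  have "I = A" if I: "I \<in> indep_sets (dual M)" "A \<subseteq> I" for I
  proof -
    obtain B' where B': "B' \<in> bases M" "I \<subseteq> ground M - B'"
      using I(1) by (rule indep_dualE)
    then have "B' \<subseteq> B" using bases_subset_ground[OF M B'(1)] B(2) I(2) by blast
    then have "B = B'" by (rule bases_maximal[OF B'(1) bases_indep[OF B(1)]])
    then show ?thesis using B'(2) B(2) I(2) by blast
  qed
  moreover have "A \<in> indep_sets (dual M)" using B by (simp add: indep_dualI)
  ultimately show "A \<in> bases (dual M)" unfolding bases_def by blast
qed

lemma bases_in_dual: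
  assumes M: "matroid M" and B: "B \<in> bases M" "B \<inter> X \<in> bases_in M X"
  shows "ground M - X - B \<in> bases_in (dual M) (ground M - X)"
proof (rule bases_inI)
  fix K assume K: "K \<in> indep_sets (dual M)" "ground M - X - B \<subseteq> K" "K \<subseteq> ground M - X"
  obtain B' where B': "B' \<in> bases M" "K \<subseteq> ground M - B'"
    using K(1) by (rule indep_dualE)
  have "B' - X \<subseteq> B" using K(2) B'(2) bases_subset_ground[OF M B'(1)] by blast
  then have "B' - X = B - X" by (rule bases_diff_subset_eq[OF M B B'(1)])
  then show "K = ground M - X - B" using K(2,3) B'(2) by blast
qed (auto intro: indep_dualI[OF B(1)])

lemma dual_augment:
  assumes M: "matroid M" and I: "I \<in> indep_sets (dual M)" "I \<notin> bases (dual M)"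
    and A: "A \<in> bases (dual M)"
  shows "\<exists>x \<in> A - I. insert x I \<in> indep_sets (dual M)"
proof -
  obtain B where B: "B \<in> bases M" "I \<subseteq> ground M - B" using I(1) by (rule indep_dualE)
  obtain B' where B': "B' \<in> bases M" "A = ground M - B'" using A bases_dual[OF M] by blast
  have "B' - I \<in> indep_sets M"
    using matroid_indep_subset[OF M bases_indep[OF B'(1)]] by blast
  then obtain B'' where B'': "B'' \<in> bases M" "B' - I \<subseteq> B''" "B'' \<subseteq> (B' - I) \<union> B"
    by (rule base_between[OF M _ B(1)])
  have disjoint: "I \<subseteq> ground M - B''" using B(2) B''(3) by blast
  have "ground M - B'' \<noteq> I" using I(2) B''(1) bases_dual[OF M] by blast
  then obtain x where x: "x \<in> ground M - B''" "x \<notin> I" using disjoint by blast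
  then have "insert x I \<in> indep_sets (dual M)"
    using disjoint by (intro indep_dualI[OF B''(1)]) blast
  then show ?thesis using x B'(2) B''(2) by blast
qed

lemma indep_dual_extends_to_bases_in:
  assumes M: "matroid M" and I: "I \<in> indep_sets (dual M)" "I \<subseteq> X" and X: "X \<subseteq> ground M"
  shows "\<exists>J \<in> bases_in (dual M) X. I \<subseteq> J"
proof -
  let ?Y = "ground M - X"
  obtain B where B: "B \<in> bases M" "I \<subseteq> ground M - B" using I(1) by (rule indep_dualE)
  obtain S where S: "S \<in> bases_in M ?Y" by (rule bases_in_exists[OF M])
  obtain B' where B': "B' \<in> bases M" "S \<subseteq> B'" "B' \<subseteq> S \<union> B"
    by (rule base_between[OF M bases_in_indep[OF S] B(1)])
  have "B' \<inter> ?Y = S" by (rule bases_in_Int_indep[OF M S bases_indep[OF B'(1)] B'(2)])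
  then have "X - B' \<in> bases_in (dual M) X"
    using bases_in_dual[OF M B'(1), of ?Y] S by (simp add: double_diff[OF X])
  moreover have "I \<subseteq> X - B'" using I(2) B(2) B'(3) bases_in_subset[OF S] by blast
  ultimately show ?thesis by blast
qed

lemma matroid_dual:
  assumes M: "matroid M"
  shows "matroid (dual M)"
proof (rule matroidI)
  obtain B where "B \<in> bases M"
    by (rule indep_extends_to_base[OF M matroid_empty_indep[OF M]])
  then show "{} \<in> indep_sets (dual M)" by (simp add: indep_dualI)
qed (auto elim!: indep_dualE intro: indep_dualI
       simp: dual_augment[OF M] indep_dual_extends_to_bases_in[OF M])

lemma dual_dual:
  assumes M: "matroid M"
  shows "dual (dual M) = M"
proof (rule indep_system.expand, intro conjI set_eqI iffI)
  fix I assume "I \<in> indep_sets (dual (dual M))"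
  then obtain A where A: "A \<in> bases (dual M)" "I \<subseteq> ground M - A"
    by (rule indep_dualE) simp
  then obtain B where "B \<in> bases M" "A = ground M - B"
    using bases_dual[OF M] by blast
  then show "I \<in> indep_sets M"
    using A(2) matroid_indep_subset[OF M bases_indep, of B I] by blast
next
  fix I assume "I \<in> indep_sets M"
  then obtain B where B: "B \<in> bases M" "I \<subseteq> B" by (rule indep_extends_to_base[OF M])
  have "ground M - B \<in> bases (dual M)" using B(1) bases_dual[OF M] by blast
  then show "I \<in> indep_sets (dual (dual M))"
    using B bases_subset_ground[OF M B(1)] by (intro indep_dualI) auto
qed simp_all

section \<open>Minors\<close>

lemma ground_deletion [simp]: "ground (deletion M G) = ground M - G"
  by (simp add: deletion_def)

lemma indep_deletion_iff:
  "I \<in> indep_sets (deletion M G) \<longleftrightarrow> I \<in> indep_sets M \<and> I \<subseteq> ground M - G"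
  by (simp add: deletion_def)

lemma bases_deletion: "bases (deletion M G) = bases_in M (ground M - G)"
proof (rule set_eqI)
  show "B \<in> bases (deletion M G) \<longleftrightarrow> B \<in> bases_in M (ground M - G)" for B
    unfolding bases_def bases_in_def mem_Collect_eq Ball_def indep_deletion_iff by metis
qed

lemma bases_in_deletion:
  assumes "X \<subseteq> ground M - G"
  shows "bases_in (deletion M G) X = bases_in M X"
proof -
  have "I \<in> indep_sets (deletion M G) \<longleftrightarrow> I \<in> indep_sets M" if "I \<subseteq> X" for I
    using that assms by (auto simp: indep_deletion_iff)
  then show ?thesis unfolding bases_in_def by (intro Collect_cong) metis
qed

lemma matroid_deletion:
  assumes M: "matroid M"
  shows "matroid (deletion M G)"
proof (rule matroidI)
  fix I B
  assume "I \<in> indep_sets (deletion M G)" "I \<notin> bases (deletion M G)" "B \<in> bases (deletion M G)"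
  then have I: "I \<in> indep_sets M" "I \<subseteq> ground M - G" "I \<notin> bases_in M (ground M - G)"
    and B: "B \<in> bases_in M (ground M - G)"
    by (simp_all add: indep_deletion_iff bases_deletion)
  then show "\<exists>x \<in> B - I. insert x I \<in> indep_sets (deletion M G)"
    using bases_in_augment[OF M I B] bases_in_subset[OF B] unfolding indep_deletion_iff by blast
next
  fix I X
  assume "I \<in> indep_sets (deletion M G)" "I \<subseteq> X" "X \<subseteq> ground (deletion M G)"
  then have I: "I \<in> indep_sets M" "I \<subseteq> X" and X: "X \<subseteq> ground M - G"
    by (simp_all add: indep_deletion_iff)
  obtain J where "J \<in> bases_in M X" "I \<subseteq> J"
    by (rule indep_extends_to_bases_in[OF M I])
  then show "\<exists>J \<in> bases_in (deletion M G) X. I \<subseteq> J"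
    unfolding bases_in_deletion[OF X] by (rule bexI[rotated])
next
  show "{} \<in> indep_sets (deletion M G)"
    using matroid_empty_indep[OF M] by (simp add: indep_deletion_iff)
next
  show "J \<in> indep_sets (deletion M G)" if "I \<in> indep_sets (deletion M G)" "J \<subseteq> I" for I J
    using that matroid_indep_subset[OF M] unfolding indep_deletion_iff by blast
qed (simp add: indep_deletion_iff)

lemma ground_contraction [simp]: "ground (contraction M F) = ground M - F"
  by (simp add: contraction_def)

lemma matroid_contraction: "matroid M \<Longrightarrow> matroid (contraction M F)"
  by (simp add: contraction_def matroid_dual matroid_deletion)

lemma indep_contraction_iff:
  assumes M: "matroid M" and S: "S \<in> bases_in M F"
  shows "I \<in> indep_sets (contraction M F) \<longleftrightarrow> I \<subseteq> ground M - F \<and> I \<union> S \<in> indep_sets M"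
proof
  let ?X = "ground M - F"
  assume "I \<in> indep_sets (contraction M F)"
  then obtain A where A: "A \<in> bases_in (dual M) ?X" "I \<subseteq> ?X - A"
    unfolding contraction_def by (rule indep_dualE) (simp add: bases_deletion)
  obtain B where B: "B \<in> bases M" "A \<subseteq> ground M - B"
    by (rule indep_dualE[OF bases_in_indep[OF A(1)]])
  obtain B' where B': "B' \<in> bases M" "S \<subseteq> B'" "B' \<subseteq> S \<union> B"
    by (rule base_between[OF M bases_in_indep[OF S] B(1)])
  have "?X - B' \<in> indep_sets (dual M)" by (rule indep_dualI[OF B'(1)]) blast
  moreover have "A \<subseteq> ?X - B'"
    using B(2) B'(3) bases_in_subset[OF S] bases_in_subset[OF A(1)] by blast
  ultimately have "?X - B' = A" using Diff_subset by (rule bases_in_maximal[OF A(1)])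
  then have "I \<union> S \<subseteq> B'" using A(2) B'(2) by blast
  then have "I \<union> S \<in> indep_sets M" by (rule matroid_indep_subset[OF M bases_indep[OF B'(1)]])
  then show "I \<subseteq> ?X \<and> I \<union> S \<in> indep_sets M" using A(2) by blast
next
  let ?X = "ground M - F"
  assume I: "I \<subseteq> ?X \<and> I \<union> S \<in> indep_sets M"
  then obtain B where B: "B \<in> bases M" "I \<union> S \<subseteq> B"
    using indep_extends_to_base[OF M] by blast
  have "B \<inter> F = S" using bases_in_Int_indep[OF M S bases_indep[OF B(1)]] B(2) by blast
  then have "?X - B \<in> bases (deletion (dual M) F)"
    using bases_in_dual[OF M B(1), of F] S by (simp add: bases_deletion)
  moreover have "I \<subseteq> ?X - (?X - B)" using I B(2) by blast
  ultimately show "I \<in> indep_sets (contraction M F)"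
    unfolding contraction_def by (intro indep_dualI) auto
qed

lemma contraction_deletion:
  assumes M: "matroid M" and "F \<subseteq> ground M" "F \<inter> G = {}"
  shows "contraction (deletion M G) F = deletion (contraction M F) G"
proof (rule indep_system.expand, intro conjI set_eqI)
  obtain S where S: "S \<in> bases_in M F" by (rule bases_in_exists[OF M])
  have F: "F \<subseteq> ground M - G" using assms(2,3) by blast
  then have S': "S \<in> bases_in (deletion M G) F" using S by (simp add: bases_in_deletion)
  have "S \<subseteq> ground M - G" using F bases_in_subset[OF S] by blast
  then show "I \<in> indep_sets (contraction (deletion M G) F) \<longleftrightarrow>
      I \<in> indep_sets (deletion (contraction M F) G)" for I
    unfolding indep_contraction_iff[OF matroid_deletion[OF M] S'] indep_deletion_iff
      indep_contraction_iff[OF M S] ground_deletion ground_contraction by blast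
qed auto

definition minor :: "'a indep_system \<Rightarrow> 'a set \<Rightarrow> 'a set \<Rightarrow> 'a indep_system" where
  "minor M F G = deletion (contraction M F) G"

lemma ground_minor [simp]: "ground (minor M F G) = ground M - F - G"
  by (simp add: minor_def)

lemma matroid_minor: "matroid M \<Longrightarrow> matroid (minor M F G)"
  by (simp add: minor_def matroid_contraction matroid_deletion)

lemma dual_minor:
  assumes "matroid M" "G \<subseteq> ground M" "F \<inter> G = {}"
  shows "dual (minor M F G) = minor (dual M) G F"
proof -
  have "dual (minor M F G) = contraction (deletion (dual M) F) G"
    by (simp add: minor_def contraction_def)
  also have "\<dots> = deletion (contraction (dual M) G) F"
    using assms by (intro contraction_deletion) (auto simp: matroid_dual)
  finally show ?thesis by (simp add: minor_def)
qed

section \<open>Circuits and cocircuits\<close>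

lemma circuits_dependent: "C \<in> circuits M \<Longrightarrow> C \<notin> indep_sets M"
  by (simp add: circuits_def)

lemma circuits_subset_ground: "C \<in> circuits M \<Longrightarrow> C \<subseteq> ground M"
  by (simp add: circuits_def)

lemma circuits_minimal: "C \<in> circuits M \<Longrightarrow> D \<subset> C \<Longrightarrow> D \<in> indep_sets M"
  by (simp add: circuits_def)

lemma indep_insert_Diff:
  assumes M: "matroid M" and I: "I \<in> indep_sets M"
    and J: "J \<in> bases_in M (insert z I)" and y: "y \<in> insert z I" "y \<notin> J"
  shows "insert z I - {y} \<in> indep_sets M"
proof (cases "y = z")
  case True
  then show ?thesis by (intro matroid_indep_subset[OF M I]) blast
next
  case False
  then have "y \<in> I" using y(1) by blast
  then have "I - {y} \<notin> bases_in M (insert z I)"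
    using bases_in_maximal[of "I - {y}" M _ I] I by blast
  moreover have "I - {y} \<in> indep_sets M" by (rule matroid_indep_subset[OF M I Diff_subset])
  ultimately obtain x where x: "x \<in> J - (I - {y})" "insert x (I - {y}) \<in> indep_sets M"
    using bases_in_augment[OF M _ _ _ J] by blast
  have "x = z" using x(1) y(2) bases_in_subset[OF J] by blast
  then show ?thesis using x(2) False by (simp add: insert_Diff_if)
qed

text \<open>In an infinite dependent set a circuit cannot be found by choosing a minimal dependent
  subset. The fundamental circuit consists of the elements that can be exchanged for \<open>z\<close>.\<close>

lemma fundamental_circuit:
  assumes M: "matroid M" and I: "I \<in> indep_sets M" and z: "z \<in> ground M"
    and dep: "insert z I \<notin> indep_sets M"
  obtains C where "C \<in> circuits M" "z \<in> C" "C \<subseteq> insert z I"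
proof -
  let ?X = "insert z I"
  define C where "C = {x \<in> ?X. ?X - {x} \<in> indep_sets M}"
  have "C \<subseteq> ?X" by (auto simp: C_def)
  have "z \<in> C" using matroid_indep_subset[OF M I, of "?X - {z}"] by (auto simp: C_def)
  have "C \<notin> indep_sets M"
  proof
    assume "C \<in> indep_sets M"
    then obtain J where J: "J \<in> bases_in M ?X" "C \<subseteq> J"
      using \<open>C \<subseteq> ?X\<close> by (rule indep_extends_to_bases_in[OF M])
    have "J \<noteq> ?X" using bases_in_indep[OF J(1)] dep by metis
    then obtain y where y: "y \<in> ?X" "y \<notin> J" using bases_in_subset[OF J(1)] by blast
    then have "y \<in> C" using indep_insert_Diff[OF M I J(1)] by (simp add: C_def)
    then show False using y(2) J(2) by blast
  qed
  moreover have "D \<in> indep_sets M" if D: "D \<subset> C" for D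
  proof -
    obtain x where "x \<in> C" "x \<notin> D" using D by blast
    then have "?X - {x} \<in> indep_sets M" "D \<subseteq> ?X - {x}" using D by (auto simp: C_def)
    then show ?thesis by (rule matroid_indep_subset[OF M])
  qed
  moreover have "C \<subseteq> ground M"
    using \<open>C \<subseteq> ?X\<close> z matroid_indep_subset_ground[OF M I] by blast
  ultimately have "C \<in> circuits M" by (simp add: circuits_def)
  then show thesis using \<open>z \<in> C\<close> \<open>C \<subseteq> ?X\<close> by (rule that)
qed

lemma dependent_contains_circuit:
  assumes M: "matroid M" and X: "X \<subseteq> ground M" "X \<notin> indep_sets M"
  obtains C where "C \<in> circuits M" "C \<subseteq> X"
proof -
  obtain I where I: "I \<in> bases_in M X" by (rule bases_in_exists[OF M])
  have "I \<subseteq> X" "I \<noteq> X" using bases_in_subset[OF I] bases_in_indep[OF I] X(2) by auto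
  then obtain z where z: "z \<in> X" "z \<notin> I" by blast
  have "insert z I \<notin> indep_sets M"
    using bases_in_maximal[OF I, of "insert z I"] z \<open>I \<subseteq> X\<close> by blast
  then obtain C where C: "C \<in> circuits M" "C \<subseteq> insert z I"
    using fundamental_circuit[OF M bases_in_indep[OF I]] z(1) X(1) by blast
  have "C \<subseteq> X" using C(2) z(1) \<open>I \<subseteq> X\<close> by blast
  then show thesis by (rule that[OF C(1)])
qed

lemma circuit_Int_cocircuit_not_singleton:
  assumes M: "matroid M" and C: "C \<in> circuits M" and U: "U \<in> circuits (dual M)"
  shows "C \<inter> U \<noteq> {x}"
proof
  assume x: "C \<inter> U = {x}"
  have "U - {x} \<in> indep_sets (dual M)" using circuits_minimal[OF U] x by blast
  then obtain B where B: "B \<in> bases M" "U - {x} \<subseteq> ground M - B" by (rule indep_dualE)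
  have "C - {x} \<in> indep_sets M" using circuits_minimal[OF C] x by blast
  then obtain B' where B': "B' \<in> bases M" "C - {x} \<subseteq> B'" "B' \<subseteq> (C - {x}) \<union> B"
    by (rule base_between[OF M _ B(1)])
  have "\<not> C \<subseteq> B'"
    using circuits_dependent[OF C] matroid_indep_subset[OF M bases_indep[OF B'(1)]] by blast
  then have "x \<notin> B'" using B'(2) by blast
  then have "U \<subseteq> ground M - B'" using circuits_subset_ground[OF U] B'(3) B(2) x by auto
  then show False using circuits_dependent[OF U] indep_dualI[OF B'(1)] by blast
qed

lemma circuit_Int_cocircuit_pair:
  assumes M: "matroid M" and C: "C \<in> circuits M" and ef: "e \<in> C" "f \<in> C" "e \<noteq> f"
  obtains U where "U \<in> circuits (dual M)" "C \<inter> U = {e, f}"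
proof -
  have "C - {e} \<in> indep_sets M" using circuits_minimal[OF C] ef(1) by blast
  then obtain B where B: "B \<in> bases M" "C - {e} \<subseteq> B" by (rule indep_extends_to_base[OF M])
  let ?A = "ground M - B"
  have A: "?A \<in> bases (dual M)" using B(1) bases_dual[OF M] by blast
  have "f \<notin> ?A" using B(2) ef by blast
  then have "insert f ?A \<notin> indep_sets (dual M)"
    using bases_maximal[OF A, of "insert f ?A"] by blast
  moreover have "f \<in> ground (dual M)" using ef(2) circuits_subset_ground[OF C] by auto
  ultimately obtain U where U: "U \<in> circuits (dual M)" "f \<in> U" "U \<subseteq> insert f ?A"
    using fundamental_circuit[OF matroid_dual[OF M] bases_indep[OF A]] by blast
  have "C \<inter> U \<subseteq> {e, f}" using U(3) B(2) by blast
  moreover have "C \<inter> U \<noteq> {f}" by (rule circuit_Int_cocircuit_not_singleton[OF M C U(1)])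
  ultimately have "C \<inter> U = {e, f}" using ef(2) U(2) by blast
  then show thesis using that U(1) by blast
qed

lemma circuits_deletion: "C \<in> circuits (deletion M G) \<Longrightarrow> C \<in> circuits M"
  unfolding circuits_def by (auto simp: indep_deletion_iff)

lemma circuit_contraction_lift:
  assumes M: "matroid M" and D: "D \<in> circuits (contraction M F)"
  obtains C where "C \<in> circuits M" "D \<subseteq> C" "C \<subseteq> D \<union> F"
proof -
  obtain S where S: "S \<in> bases_in M F" by (rule bases_in_exists[OF M])
  note indep_iff = indep_contraction_iff[OF M S]
  have DF: "D \<subseteq> ground M - F" using circuits_subset_ground[OF D] by simp
  then have "D \<union> S \<notin> indep_sets M" using circuits_dependent[OF D] indep_iff by blast
  moreover have "D \<union> S \<subseteq> ground M"
    using DF matroid_indep_subset_ground[OF M bases_in_indep[OF S]] by blast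
  ultimately obtain C where C: "C \<in> circuits M" "C \<subseteq> D \<union> S"
    using dependent_contains_circuit[OF M] by blast
  have "x \<in> C" if "x \<in> D" for x
  proof (rule ccontr)
    assume "x \<notin> C"
    then have "C \<subseteq> (D - {x}) \<union> S" using C(2) by blast
    moreover have "(D - {x}) \<union> S \<in> indep_sets M"
      using circuits_minimal[OF D, of "D - {x}"] that indep_iff by blast
    ultimately show False
      using circuits_dependent[OF C(1)] matroid_indep_subset[OF M] by blast
  qed
  moreover have "C \<subseteq> D \<union> F" using C(2) bases_in_subset[OF S] by blast
  ultimately show thesis using C(1) by (intro that) auto
qed

section \<open>Signed sets and signatures\<close>

lemma support_restriction [simp]: "support (restriction C A) = support C \<inter> A"
  by (auto simp: support_def)

lemma support_opposite [simp]: "support (opposite C) = support C"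
  by (auto simp: support_def)

lemma opposite_opposite [simp]: "opposite (opposite C) = C"
  by (rule signed_set_eqI) simp_all

lemma restriction_opposite: "restriction (opposite C) A = opposite (restriction C A)"
  by (rule signed_set_eqI) simp_all

lemma sign_restriction: "e \<in> A \<Longrightarrow> sign (restriction C A) e = sign C e"
  by (simp add: sign_def)

lemma sign_opposite: "sign (opposite C) e = - sign C e"
  using pos_neg_disjoint[of C] by (auto simp: sign_def)

lemma sign_cases: "e \<in> support C \<Longrightarrow> sign C e = 1 \<or> sign C e = - 1"
  by (auto simp: support_def sign_def)

lemma pos_iff_sign: "e \<in> pos C \<longleftrightarrow> sign C e = 1"
  by (simp add: sign_def)

lemma neg_iff_sign: "e \<in> neg C \<longleftrightarrow> sign C e = - 1"
  using pos_neg_disjoint[of C] by (auto simp: sign_def)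

lemma restriction_eqI:
  "(\<And>e. e \<in> A \<Longrightarrow> sign C e = sign D e) \<Longrightarrow> restriction C A = restriction D A"
  by (rule signed_set_eqI) (auto simp: pos_iff_sign neg_iff_sign)

lemma restriction_eq_or_opposite:
  assumes support: "A \<subseteq> support C" "A \<subseteq> support D"
    and relative: "\<And>e f. e \<in> A \<Longrightarrow> f \<in> A \<Longrightarrow> e \<noteq> f \<Longrightarrow> sign C e * sign C f = sign D e * sign D f"
  shows "restriction C A = restriction D A \<or> restriction C A = opposite (restriction D A)"
proof (cases "\<forall>e \<in> A. sign C e = sign D e")
  case True
  then show ?thesis using restriction_eqI[of A C D] by simp
next
  case False
  then obtain e where e: "e \<in> A" "sign C e \<noteq> sign D e" by blast
  then have "e \<in> support C" "e \<in> support D" using support by blast+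
  then have opposite_at: "sign C e = - sign D e" "sign D e \<noteq> 0"
    using sign_cases[of e C] sign_cases[of e D] e(2) by auto
  have "sign C f = sign (opposite D) f" if "f \<in> A" for f
  proof (cases "e = f")
    case False
    then have "sign D e * sign C f = sign D e * - sign D f"
      using relative[OF e(1) that] opposite_at(1) by simp
    then show ?thesis unfolding mult_left_cancel[OF opposite_at(2)] by (simp add: sign_opposite)
  qed (use opposite_at(1) in \<open>simp add: sign_opposite\<close>)
  then show ?thesis using restriction_eqI[of A C "opposite D"] by (simp add: restriction_opposite)
qed

lemma orthogonal_sym: "orthogonal C U \<Longrightarrow> orthogonal U C"
  unfolding orthogonal_def by (simp add: Int_commute mult.commute)

lemma orthogonal_restriction:
  assumes "orthogonal C U" "support C \<inter> support U \<subseteq> A \<inter> B"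
  shows "orthogonal (restriction C A) (restriction U B)"
proof (cases "support C \<inter> support U = {}")
  case True
  then show ?thesis by (auto simp: orthogonal_def)
next
  case False
  then obtain e f where "e \<in> support C \<inter> support U" "f \<in> support C \<inter> support U"
    "sign C e * sign U e = - (sign C f * sign U f)"
    using assms(1) unfolding orthogonal_def by blast
  moreover from this have "e \<in> A" "e \<in> B" "f \<in> A" "f \<in> B" using assms(2) by blast+
  ultimately show ?thesis unfolding orthogonal_def
    by (intro disjI2 bexI[where x = e] bexI[where x = f]) (simp_all add: sign_restriction)
qed

lemma orthogonal_Int_pair:
  assumes "orthogonal C U" "support C \<inter> support U = {e, f}"
  shows "sign C e * sign C f = - (sign U e * sign U f)"
proof -
  have "e \<in> support C" "e \<in> support U" "f \<in> support C" "f \<in> support U"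
    using assms(2) by blast+
  note this[THEN sign_cases]
  moreover have "\<exists>x \<in> {e, f}. \<exists>y \<in> {e, f}. sign C x * sign U x = - (sign C y * sign U y)"
    using assms unfolding orthogonal_def by auto
  ultimately show ?thesis by auto
qed

lemma circuit_signature_support: "circuit_signature M \<C> \<Longrightarrow> C \<in> \<C> \<Longrightarrow> support C \<in> circuits M"
  by (simp add: circuit_signature_def)

lemma circuit_signature_class:
  assumes "circuit_signature M \<C>" "D \<in> circuits M"
  obtains C where "{Y \<in> \<C>. support Y = D} = {C, opposite C}"
  using assms unfolding circuit_signature_def by metis

lemma circuit_signature_signing:
  assumes "circuit_signature M \<C>" "D \<in> circuits M"
  obtains C where "C \<in> \<C>" "support C = D"
proof -
  obtain C where "{Y \<in> \<C>. support Y = D} = {C, opposite C}"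
    by (rule circuit_signature_class[OF assms])
  then have "C \<in> {Y \<in> \<C>. support Y = D}" by simp
  then show thesis using that by blast
qed

lemma circuit_signature_opposite:
  assumes \<C>: "circuit_signature M \<C>" and C: "C \<in> \<C>"
  shows "opposite C \<in> \<C>"
proof -
  obtain Z where "{Y \<in> \<C>. support Y = support C} = {Z, opposite Z}"
    by (rule circuit_signature_class[OF \<C> circuit_signature_support[OF \<C> C]])
  moreover from this have "C = Z \<or> C = opposite Z" using C by blast
  ultimately have "opposite C \<in> {Y \<in> \<C>. support Y = support C}" by auto
  then show ?thesis by simp
qed

lemma circuit_signatureI:
  assumes "\<And>C. C \<in> \<C> \<Longrightarrow> support C \<in> circuits M"
    and "\<And>D. D \<in> circuits M \<Longrightarrow> \<exists>C \<in> \<C>. support C = D"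
    and "\<And>C. C \<in> \<C> \<Longrightarrow> opposite C \<in> \<C>"
    and "\<And>C C'. C \<in> \<C> \<Longrightarrow> C' \<in> \<C> \<Longrightarrow> support C = support C' \<Longrightarrow> C = C' \<or> C = opposite C'"
  shows "circuit_signature M \<C>"
  unfolding circuit_signature_def
proof (intro conjI ballI)
  fix D assume "D \<in> circuits M"
  then obtain C where "C \<in> \<C>" "support C = D" using assms(2) by blast
  then have "{Y \<in> \<C>. support Y = D} = {C, opposite C}" using assms(3,4) by auto
  then show "\<exists>C. {Y \<in> \<C>. support Y = D} = {C, opposite C}" by blast
qed (rule assms(1))

section \<open>Induced signatures of minors\<close>

definition signed_lifts :: "'a signed_set set \<Rightarrow> 'a set \<Rightarrow> 'a set \<Rightarrow> 'a signed_set set" where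
  "signed_lifts \<C> F D = {C \<in> \<C>. D \<subseteq> support C \<and> support C \<subseteq> D \<union> F}"

definition induced_signature ::
    "'a indep_system \<Rightarrow> 'a signed_set set \<Rightarrow> 'a set \<Rightarrow> 'a signed_set set" where
  "induced_signature N \<C> F = {restriction C D | C D. D \<in> circuits N \<and> C \<in> signed_lifts \<C> F D}"

lemma induced_signatureI:
  "D \<in> circuits N \<Longrightarrow> C \<in> signed_lifts \<C> F D \<Longrightarrow> restriction C D \<in> induced_signature N \<C> F"
  unfolding induced_signature_def by blast

lemma induced_signatureE:
  assumes "Y \<in> induced_signature N \<C> F"
  obtains C D where "Y = restriction C D" "support Y = D"
    "D \<in> circuits N" "C \<in> signed_lifts \<C> F D"
proof -
  obtain C D where C: "Y = restriction C D" "D \<in> circuits N" "C \<in> signed_lifts \<C> F D"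
    using assms unfolding induced_signature_def by blast
  moreover have "support Y = D" using C(1,3) by (auto simp: signed_lifts_def)
  ultimately show thesis by (intro that)
qed

lemma signed_lift_exists:
  assumes M: "matroid M" and \<C>: "circuit_signature M \<C>" and D: "D \<in> circuits (minor M F G)"
  obtains C where "C \<in> signed_lifts \<C> F D"
proof -
  have "D \<in> circuits (contraction M F)"
    using D unfolding minor_def by (rule circuits_deletion)
  then obtain K where K: "K \<in> circuits M" "D \<subseteq> K" "K \<subseteq> D \<union> F"
    by (rule circuit_contraction_lift[OF M])
  obtain C where "C \<in> \<C>" "support C = K"
    by (rule circuit_signature_signing[OF \<C> K(1)])
  then have "C \<in> signed_lifts \<C> F D" using K(2,3) by (simp add: signed_lifts_def)
  then show thesis by (rule that)
qed

lemma orthogonally_oriented_matroid_dual: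
  assumes "orthogonally_oriented_matroid M \<C> \<D>"
  shows "orthogonally_oriented_matroid (dual M) \<D> \<C>"
  using assms unfolding orthogonally_oriented_matroid_def cocircuit_signature_def
  by (auto simp: matroid_dual dual_dual intro: orthogonal_sym)

locale oriented_minor =
  fixes M :: "'a indep_system" and \<C> \<D> :: "'a signed_set set" and F G :: "'a set"
  assumes oriented: "orthogonally_oriented_matroid M \<C> \<D>"
    and F_ground: "F \<subseteq> ground M" and G_ground: "G \<subseteq> ground M" and disjoint: "F \<inter> G = {}"
begin

lemma matroid: "matroid M"
  and signature: "circuit_signature M \<C>"
  and cosignature: "circuit_signature (dual M) \<D>"
  and orthogonal: "C \<in> \<C> \<Longrightarrow> U \<in> \<D> \<Longrightarrow> orthogonal C U"
  using oriented by (simp_all add: orthogonally_oriented_matroid_def cocircuit_signature_def)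

lemma oriented_minor_dual: "oriented_minor (dual M) \<D> \<C> G F"
  using oriented F_ground G_ground disjoint
  by unfold_locales (auto intro: orthogonally_oriented_matroid_dual)

lemma dual_minor_eq: "dual (minor M F G) = minor (dual M) G F"
  by (rule dual_minor[OF matroid G_ground disjoint])

lemma support_lifts_Int:
  assumes D: "D \<in> circuits (minor M F G)" "C \<in> signed_lifts \<C> F D"
    and E: "E \<in> circuits (dual (minor M F G))" "U \<in> signed_lifts \<D> G E"
  shows "support C \<inter> support U = D \<inter> E"
proof -
  have "D \<inter> G = {}" "E \<inter> F = {}"
    using circuits_subset_ground[OF D(1)] circuits_subset_ground[OF E(1)] by auto
  then show ?thesis using D(2) E(2) disjoint unfolding signed_lifts_def by blast
qed

lemma lifts_orthogonal:
  "C \<in> signed_lifts \<C> F D \<Longrightarrow> U \<in> signed_lifts \<D> G E \<Longrightarrow> orthogonal C U"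
  by (simp add: signed_lifts_def orthogonal)

lemma cocircuit_lift_exists:
  assumes "E \<in> circuits (dual (minor M F G))"
  obtains U where "U \<in> signed_lifts \<D> G E"
  using assms unfolding dual_minor_eq
  by (rule signed_lift_exists[OF matroid_dual[OF matroid] cosignature])

lemma sign_product_lifts_eq:
  assumes D: "D \<in> circuits (minor M F G)"
    and C: "C \<in> signed_lifts \<C> F D" "C' \<in> signed_lifts \<C> F D"
    and ef: "e \<in> D" "f \<in> D" "e \<noteq> f"
  shows "sign C e * sign C f = sign C' e * sign C' f"
proof -
  obtain E where E: "E \<in> circuits (dual (minor M F G))" "D \<inter> E = {e, f}"
    by (rule circuit_Int_cocircuit_pair[OF matroid_minor[OF matroid] D ef])
  obtain U where U: "U \<in> signed_lifts \<D> G E" by (rule cocircuit_lift_exists[OF E(1)])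
  have "sign Y e * sign Y f = - (sign U e * sign U f)" if Y: "Y \<in> signed_lifts \<C> F D" for Y
    using orthogonal_Int_pair[OF lifts_orthogonal[OF Y U]] support_lifts_Int[OF D Y E(1) U] E(2)
    by simp
  then show ?thesis using C by simp
qed

lemma circuit_signature_minor:
  "circuit_signature (minor M F G) (induced_signature (minor M F G) \<C> F)"
    (is "circuit_signature ?N ?\<C>")
proof (rule circuit_signatureI)
  fix Y assume "Y \<in> ?\<C>"
  then show "support Y \<in> circuits ?N" by (auto elim: induced_signatureE)
next
  fix D assume D: "D \<in> circuits ?N"
  obtain C where C: "C \<in> signed_lifts \<C> F D" by (rule signed_lift_exists[OF matroid signature D])
  then have "restriction C D \<in> ?\<C>" by (rule induced_signatureI[OF D])
  moreover have "support (restriction C D) = D" using C by (auto simp: signed_lifts_def)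
  ultimately show "\<exists>Y \<in> ?\<C>. support Y = D" by blast
next
  fix Y assume "Y \<in> ?\<C>"
  then obtain C D where Y: "Y = restriction C D" "D \<in> circuits ?N" and C: "C \<in> signed_lifts \<C> F D"
    by (rule induced_signatureE)
  have "opposite C \<in> signed_lifts \<C> F D"
    using C circuit_signature_opposite[OF signature] by (simp add: signed_lifts_def)
  then have "restriction (opposite C) D \<in> ?\<C>" by (rule induced_signatureI[OF Y(2)])
  then show "opposite Y \<in> ?\<C>" by (simp add: Y(1) restriction_opposite)
next
  fix Y Y' assume Y: "Y \<in> ?\<C>" "Y' \<in> ?\<C>" "support Y = support Y'"
  obtain C D where C: "Y = restriction C D" "support Y = D"
      "D \<in> circuits ?N" "C \<in> signed_lifts \<C> F D"
    using Y(1) by (rule induced_signatureE)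
  obtain C' where C': "Y' = restriction C' D" "C' \<in> signed_lifts \<C> F D"
    using Y(2,3) C(2) by (auto elim: induced_signatureE)
  show "Y = Y' \<or> Y = opposite Y'"
    unfolding C(1) C'(1) using sign_product_lifts_eq[OF C(3,4) C'(2)] C(4) C'(2)
    by (intro restriction_eq_or_opposite) (auto simp: signed_lifts_def)
qed

lemma induced_signatures_orthogonal:
  assumes Y: "Y \<in> induced_signature (minor M F G) \<C> F"
    and Z: "Z \<in> induced_signature (dual (minor M F G)) \<D> G"
  shows "orthogonal Y Z"
proof -
  let ?N = "minor M F G"
  obtain C D where C: "Y = restriction C D" "D \<in> circuits ?N" "C \<in> signed_lifts \<C> F D"
    using Y by (rule induced_signatureE)
  obtain U E where U: "Z = restriction U E" "E \<in> circuits (dual ?N)" "U \<in> signed_lifts \<D> G E"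
    using Z by (rule induced_signatureE)
  have "support C \<inter> support U \<subseteq> D \<inter> E" by (simp add: support_lifts_Int[OF C(2,3) U(2,3)])
  then show ?thesis
    unfolding C(1) U(1) by (rule orthogonal_restriction[OF lifts_orthogonal[OF C(3) U(3)]])
qed

lemma orthogonally_oriented_matroid_minor:
  "orthogonally_oriented_matroid (minor M F G)
     (induced_signature (minor M F G) \<C> F) (induced_signature (dual (minor M F G)) \<D> G)"
  unfolding orthogonally_oriented_matroid_def cocircuit_signature_def
proof (intro conjI ballI)
  show "circuit_signature (dual (minor M F G)) (induced_signature (dual (minor M F G)) \<D> G)"
    unfolding dual_minor_eq
    by (rule oriented_minor.circuit_signature_minor[OF oriented_minor_dual])
qed (simp_all add: matroid matroid_minor circuit_signature_minor induced_signatures_orthogonal)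

end

theorem theorem3p6:
  fixes M N :: "'a indep_system"
    and \<C> \<D> \<C>\<^sub>N \<D>\<^sub>N :: "'a signed_set set"
    and X F G :: "'a set"
  assumes "orthogonally_oriented_matroid M \<C> \<D>"
    and "ground M = X \<union> F \<union> G"
    and "X \<inter> F = {}" and "X \<inter> G = {}" and "F \<inter> G = {}"
    and "N = deletion (contraction M F) G"
    and "\<C>\<^sub>N = {restriction C C' | C C'.
           C' \<in> circuits N \<and> C \<in> \<C> \<and> C' \<subseteq> support C \<and> support C \<subseteq> C' \<union> F}"
    and "\<D>\<^sub>N = {restriction U U' | U U'.
           U' \<in> cocircuits N \<and> U \<in> \<D> \<and> U' \<subseteq> support U \<and> support U \<subseteq> U' \<union> G}"
  shows "ground N = X \<and> orthogonally_oriented_matroid N \<C>\<^sub>N \<D>\<^sub>N \<and> orthogonally_orientable N"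
proof -
  interpret oriented_minor M \<C> \<D> F G
    using assms(1,2,5) by unfold_locales auto
  have N: "N = minor M F G" by (simp add: assms(6) minor_def)
  have "\<C>\<^sub>N = induced_signature N \<C> F"
    by (simp add: assms(7) induced_signature_def signed_lifts_def)
  moreover have "\<D>\<^sub>N = induced_signature (dual N) \<D> G"
    by (simp add: assms(8) induced_signature_def signed_lifts_def cocircuits_def)
  ultimately have "orthogonally_oriented_matroid N \<C>\<^sub>N \<D>\<^sub>N"
    using orthogonally_oriented_matroid_minor N by simp
  moreover have "ground N = X" using assms(2-4) by (auto simp: N)
  ultimately show ?thesis unfolding orthogonally_orientable_def by blast
qed

end
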